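(* Let $d \ge 1$ and let $\mathbb{K}$ be a field. Consider a coherent system with $d$ components and state space $\mathcal{D} = \mathbb{N}^d$, with nonfailure set $\bar{\mathcal{F}} \subseteq \mathbb{N}^d$, failure set $\mathcal{F} = \mathbb{N}^d \setminus \bar{\mathcal{F}}$, and minimal nonfailure set $\bar{\mathcal{F}}^*$. Let $R = \mathbb{K}[x_1,\ldots,x_d]$, and for $\alpha \in \mathbb{N}^d$ write $x^\alpha = x_1^{\alpha_1}\cdots x_d^{\alpha_d}$. Then: 1. The points of $\bar{\mathcal{F}}^*$ are the exponent vectors of the minimal generators of a monomial ideal $M \subseteq R$; that is, $\{x^\alpha : \alpha \in \bar{\mathcal{F}}^*\}$ is the set of minimal monomial generators of the monomial ideal $M = \langle x^\alpha : \alpha \in \bar{\mathcal{F}}^* \rangle$. 2. The points of $\bar{\mathcal{F}}$ are exactly the exponent vectors of the monomials belonging to $M$; that is, for $\alpha \in \mathbb{N}^d$, $\alpha \in \bar{\mathcal{F}}$ if and only if $x^\alpha \in M$. 3. The points of $\mathcal{F}$ are exactly the exponent vectors of the monomials of the factor ring $R/M$; that is, for $\alpha \in \mathbb{N}^d$, $\alpha \in \mathcal{F}$ if and only if $x^\alpha \notin M$.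
   Context: $\mathbb{N} = \{0,1,2,\ldots\}$. A system has $d$ components, each with increasing efficacy levels coded by $0,1,2,\ldots$; an outcome (state) is a vector $\alpha \in \mathcal{D} = \mathbb{N}^d$ giving the level of each component. The failure set $\mathcal{F} \subseteq \mathcal{D}$ is the set of outcomes at which the system fails, and the nonfailure set is $\bar{\mathcal{F}} = \mathcal{D} \setminus \mathcal{F}$. The partial order on $\mathbb{N}^d$ is componentwise: $\alpha \preceq \beta$ iff $\alpha_i \le \beta_i$ for $i = 1,\ldots,d$. The system is coherent if $\alpha \in \bar{\mathcal{F}}$ and $\alpha \preceq \beta$ imply $\beta \in \bar{\mathcal{F}}$. The minimal nonfailure set $\bar{\mathcal{F}}^*$ is the set of minimal elements of $\bar{\mathcal{F}}$ with respect to $\preceq$, i.e. the set of $\alpha \in \bar{\mathcal{F}}$ for which there is no $\beta \in \bar{\mathcal{F}}$ with $\beta \neq \alpha$ and $\beta \preceq \alpha$. A monomial ideal is an ideal generated by a set of monomials (the empty set generates the zero ideal); its minimal generators are the monomials in it that are minimal with respect to divisibility. The "monomials of the factor ring $R/M$" are the monomials $x^\alpha$ not in $M$, whose classes form the $\mathbb{K}$-basis of $R/M$. *)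

theory Defs
  imports Complex_Main "HOL-Library.Poly_Mapping"
begin

text \<open>
  The components of a system are indexed by a finite type \<open>'d\<close>, so that \<open>d = CARD('d) \<ge> 1\<close>, and a state
  is a function \<open>'d \<Rightarrow> nat\<close>. The library order on functions is the componentwise order.
\<close>

type_synonym 'd state = "'d \<Rightarrow> nat"

definition nonfailure :: "'d state set \<Rightarrow> 'd state set" where
  "nonfailure F = UNIV - F"

definition coherent :: "'d state set \<Rightarrow> bool" where
  "coherent F \<longleftrightarrow> (\<forall>\<alpha> \<beta>. \<alpha> \<in> nonfailure F \<longrightarrow> \<alpha> \<le> \<beta> \<longrightarrow> \<beta> \<in> nonfailure F)"

definition minimal_nonfailure :: "'d state set \<Rightarrow> 'd state set" where
  "minimal_nonfailure F =
     {\<alpha> \<in> nonfailure F. \<not> (\<exists>\<beta> \<in> nonfailure F. \<beta> \<noteq> \<alpha> \<and> \<beta> \<le> \<alpha>)}"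

text \<open>
  The polynomial ring over \<open>'k\<close> in indeterminates indexed by \<open>'d\<close>: finitely supported maps from
  exponents (themselves finitely supported maps \<open>'d \<Rightarrow>\<^sub>0 nat\<close>) to coefficients, with the convolution
  product.
\<close>

type_synonym ('d, 'k) polynomial = "('d \<Rightarrow>\<^sub>0 nat) \<Rightarrow>\<^sub>0 'k"

definition indet :: "'d \<Rightarrow> ('d, 'k::field) polynomial" where
  "indet i = Poly_Mapping.single (Poly_Mapping.single i 1) 1"

definition xpow :: "'d::finite state \<Rightarrow> ('d, 'k::field) polynomial" where
  "xpow \<alpha> = (\<Prod>i\<in>UNIV. indet i ^ \<alpha> i)"

text \<open>
  Ideals of a commutative ring are the submodules of the ring regarded as a module over itself, and
  the generated ideal is the span in this module.
\<close>

lemma module_times: "module ((*) :: 'a::comm_ring_1 \<Rightarrow> 'a \<Rightarrow> 'a)"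
  by standard (simp_all add: algebra_simps)

definition ideal_generated :: "'a::comm_ring_1 set \<Rightarrow> 'a set" where
  "ideal_generated S = module.span (*) S"

definition monomial_ideal :: "('d::finite, 'k::field) polynomial set \<Rightarrow> bool" where
  "monomial_ideal M \<longleftrightarrow> (\<exists>A. M = ideal_generated (xpow ` A))"

text \<open>Divisibility below is divisibility in the polynomial ring.\<close>

definition minimal_generators ::
    "('d::finite, 'k::field) polynomial set \<Rightarrow> ('d, 'k) polynomial set" where
  "minimal_generators M =
     {m \<in> range xpow \<inter> M. \<not> (\<exists>n \<in> range xpow \<inter> M. n \<noteq> m \<and> n dvd m)}"

end

theory Submission
  imports Defs
begin

text \<open>
  A product of polynomials only has exponents that are sums of exponents of the factors, so the
  polynomials all of whose exponents lie above some point of \<open>A\<close> form an ideal; hence a monomial lies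
  in the ideal generated by the monomials of \<open>A\<close> iff its exponent dominates a point of \<open>A\<close>. Since
  the componentwise order on \<open>\<nat>\<^sup>d\<close> is well-founded, the points dominating a minimal nonfailure
  point are, for a coherent system, precisely the nonfailure points.
\<close>

text \<open>States are plain functions, whereas polynomials are indexed by finitely supported maps.
  The sum of singles is the shape that multiplying out the powers in \<open>xpow\<close>
  produces.\<close>

definition exponent :: "'d::finite state \<Rightarrow> 'd \<Rightarrow>\<^sub>0 nat" where
  "exponent \<alpha> = (\<Sum>i\<in>UNIV. Poly_Mapping.single i (\<alpha> i))"

lemma lookup_exponent [simp]: "Poly_Mapping.lookup (exponent \<alpha>) = \<alpha>"
  by (rule ext) (simp add: exponent_def lookup_sum lookup_single when_def)

lemma single_power:
  "Poly_Mapping.single a (1::'k::comm_semiring_1) ^ n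
     = Poly_Mapping.single (\<Sum>_<n. a) 1"
  for a :: "'a::comm_monoid_add"
  by (induction n) (simp_all add: mult_single add.commute)

lemma prod_single:
  "finite I \<Longrightarrow> (\<Prod>i\<in>I. Poly_Mapping.single (f i) (1::'k::comm_semiring_1))
     = Poly_Mapping.single (\<Sum>i\<in>I. f i) 1"
  for f :: "'i \<Rightarrow> 'a::comm_monoid_add"
  by (induction I rule: finite_induct) (simp_all add: mult_single)

lemma xpow_eq_single:
  "(xpow \<alpha> :: ('d::finite, 'k::field) polynomial) = Poly_Mapping.single (exponent \<alpha>) 1"
proof -
  have "(\<Sum>_<n. Poly_Mapping.single i 1) = Poly_Mapping.single i n" for i :: 'd and n :: nat
    by (induction n) (simp_all flip: single_add)
  then show ?thesis
    by (simp add: xpow_def indet_def single_power prod_single exponent_def)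
qed

lemma keys_xpow [simp]:
  "Poly_Mapping.keys (xpow \<alpha> :: ('d::finite, 'k::field) polynomial) = {exponent \<alpha>}"
  by (simp add: xpow_eq_single)

lemma xpow_add:
  "(xpow (\<lambda>i. \<alpha> i + \<beta> i) :: ('d::finite, 'k::field) polynomial) = xpow \<alpha> * xpow \<beta>"
  by (simp add: xpow_def power_add prod.distrib)

lemma inj_xpow: "inj (xpow :: 'd::finite state \<Rightarrow> ('d, 'k::field) polynomial)"
proof (rule injI)
  fix \<alpha> \<beta> :: "'d state"
  assume "(xpow \<alpha> :: ('d, 'k) polynomial) = xpow \<beta>"
  then have "{exponent \<alpha>} = {exponent \<beta>}"
    by (metis keys_xpow)
  then show "\<alpha> = \<beta>"
    by (metis lookup_exponent singleton_inject)
qed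

lemma xpow_dvd_if_le:
  assumes "\<alpha> \<le> \<beta>"
  shows "(xpow \<alpha> :: ('d::finite, 'k::field) polynomial) dvd xpow \<beta>"
proof -
  \<comment> \<open>Subtraction on naturals truncates, but here \<alpha> \<le> \<beta> makes the
    difference exact in every coordinate.\<close>
  have "\<beta> = (\<lambda>i. \<alpha> i + (\<beta> i - \<alpha> i))"
    using assms by (auto simp: le_fun_def)
  then show ?thesis
    by (metis dvd_triv_left xpow_add)
qed

text \<open>A key of the product is a sum of a key of \<open>p\<close> and a key of
  \<open>q\<close>, and adding a vector of naturals never lowers a coordinate.\<close>

lemma key_mult_above:
  fixes p q :: "('d, 'k::field) polynomial"
  assumes "\<gamma> \<in> Poly_Mapping.keys (p * q)"
  obtains \<delta> where "\<delta> \<in> Poly_Mapping.keys q" "Poly_Mapping.lookup \<delta> \<le> Poly_Mapping.lookup \<gamma>"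
proof -
  obtain \<epsilon> \<delta> where "\<delta> \<in> Poly_Mapping.keys q" "\<gamma> = \<epsilon> + \<delta>"
    using assms keys_mult[of p q] by blast
  then show thesis
    by (intro that) (auto simp: le_fun_def lookup_add)
qed

lemma xpow_dvd_iff:
  "(xpow \<alpha> :: ('d::finite, 'k::field) polynomial) dvd xpow \<beta> \<longleftrightarrow> \<alpha> \<le> \<beta>"
proof
  assume "(xpow \<alpha> :: ('d, 'k) polynomial) dvd xpow \<beta>"
  then obtain q :: "('d, 'k) polynomial" where "xpow \<beta> = q * xpow \<alpha>"
    by (metis dvdE mult.commute)
  \<comment> \<open>The cofactor \<open>q\<close> may be any polynomial, so keys are compared: the
    only key of \<open>xpow \<alpha>\<close> lies below that of the product.\<close>
  then have "exponent \<beta> \<in> Poly_Mapping.keys (q * xpow \<alpha>)"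
    by (metis keys_xpow singletonI)
  then show "\<alpha> \<le> \<beta>"
    by (elim key_mult_above) simp
qed (rule xpow_dvd_if_le)

text \<open>All keys of an arbitrary member are treated, not just monomials, because a condition on
  whole polynomials is what can be closed under sums and multiples.\<close>

lemma key_in_ideal_generated:
  fixes p :: "('d::finite, 'k::field) polynomial"
  assumes "p \<in> ideal_generated (xpow ` A)" and "\<gamma> \<in> Poly_Mapping.keys p"
  shows "\<exists>\<alpha>\<in>A. \<alpha> \<le> Poly_Mapping.lookup \<gamma>"
proof -
  let ?B = "{q :: ('d, 'k) polynomial.
    \<forall>\<gamma>\<in>Poly_Mapping.keys q. \<exists>\<alpha>\<in>A. \<alpha> \<le> Poly_Mapping.lookup \<gamma>}"
  have "module.subspace (*) ?B"
  proof (rule module.subspaceI[OF module_times])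
    show "p + q \<in> ?B" if "p \<in> ?B" "q \<in> ?B" for p q
      using that keys_add[of p q] by blast
    show "c * q \<in> ?B" if "q \<in> ?B" for c q
    proof (clarify)
      fix \<gamma>
      assume "\<gamma> \<in> Poly_Mapping.keys (c * q)"
      then obtain \<delta> where "\<delta> \<in> Poly_Mapping.keys q"
        and "Poly_Mapping.lookup \<delta> \<le> Poly_Mapping.lookup \<gamma>"
        by (rule key_mult_above)
      with that show "\<exists>\<alpha>\<in>A. \<alpha> \<le> Poly_Mapping.lookup \<gamma>"
        using order_trans by blast
    qed
  qed simp
  then have "ideal_generated (xpow ` A) \<subseteq> ?B"
    unfolding ideal_generated_def by (intro module.span_minimal[OF module_times]) auto
  with assms show ?thesis
    by blast
qed

lemma xpow_in_ideal_generated_iff: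
  "(xpow \<beta> :: ('d::finite, 'k::field) polynomial) \<in> ideal_generated (xpow ` A)
     \<longleftrightarrow> (\<exists>\<alpha>\<in>A. \<alpha> \<le> \<beta>)"
proof
  assume "(xpow \<beta> :: ('d, 'k) polynomial) \<in> ideal_generated (xpow ` A)"
  from key_in_ideal_generated[OF this] show "\<exists>\<alpha>\<in>A. \<alpha> \<le> \<beta>"
    by simp
next
  assume "\<exists>\<alpha>\<in>A. \<alpha> \<le> \<beta>"
  then obtain \<alpha> where "\<alpha> \<in> A" "\<alpha> \<le> \<beta>"
    by blast
  then obtain q :: "('d, 'k) polynomial" where "xpow \<beta> = q * xpow \<alpha>"
    by (metis xpow_dvd_if_le dvdE mult.commute)
  with \<open>\<alpha> \<in> A\<close> show "(xpow \<beta> :: ('d, 'k) polynomial) \<in> ideal_generated (xpow ` A)"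
    by (simp add: ideal_generated_def module.span_scale[OF module_times]
        module.span_base[OF module_times])
qed

text \<open>Descent on the total level: a nonfailure state that is not minimal has a different one
  below it, which is strictly smaller in some coordinate and hence in the sum.\<close>

lemma minimal_nonfailure_below:
  fixes F :: "'d::finite state set"
  assumes "\<beta> \<in> nonfailure F"
  shows "\<exists>\<alpha>\<in>minimal_nonfailure F. \<alpha> \<le> \<beta>"
  using assms
proof (induction "sum \<beta> UNIV" arbitrary: \<beta> rule: less_induct)
  case less
  show ?case
  proof (cases "\<beta> \<in> minimal_nonfailure F")
    case False
    then obtain \<gamma> where \<gamma>: "\<gamma> \<in> nonfailure F" "\<gamma> \<noteq> \<beta>" "\<gamma> \<le> \<beta>"
      using less.prems by (auto simp: minimal_nonfailure_def)
    then obtain i where "\<gamma> i < \<beta> i"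
      by (metis ext le_funD nat_less_le)
    then have "sum \<gamma> UNIV < sum \<beta> UNIV"
      using \<gamma>(3) by (intro sum_strict_mono_ex1) (auto simp: le_fun_def)
    then show ?thesis
      using less.hyps \<gamma> order_trans by blast
  qed blast
qed

text \<open>Descent gives the forward direction; coherence carries nonfailure upwards for the
  converse.\<close>

lemma coherent_nonfailure_iff:
  fixes F :: "'d::finite state set"
  assumes "coherent F"
  shows "\<beta> \<in> nonfailure F \<longleftrightarrow> (\<exists>\<alpha>\<in>minimal_nonfailure F. \<alpha> \<le> \<beta>)"
  using assms minimal_nonfailure_below[of \<beta> F]
  by (auto simp: coherent_def minimal_nonfailure_def)

theorem proposition1:
  fixes F :: "'d::finite state set"
    and M :: "('d, 'k::field) polynomial set"
  assumes "coherent F"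
    and "M = ideal_generated (xpow ` minimal_nonfailure F)"
  shows "(monomial_ideal M
          \<and> minimal_generators M = xpow ` minimal_nonfailure F
          \<and> minimal_nonfailure F = {\<alpha>. xpow \<alpha> \<in> minimal_generators M})
         \<and> (\<forall>\<alpha>. \<alpha> \<in> nonfailure F \<longleftrightarrow> xpow \<alpha> \<in> M)
         \<and> (\<forall>\<alpha>. \<alpha> \<in> F \<longleftrightarrow> xpow \<alpha> \<notin> M)"
proof -
  have mem: "xpow \<alpha> \<in> M \<longleftrightarrow> \<alpha> \<in> nonfailure F" for \<alpha>
    by (simp add: assms xpow_in_ideal_generated_iff coherent_nonfailure_iff)
  have "range xpow \<inter> M = xpow ` nonfailure F"
    using mem by blast
  \<comment> \<open>Since \<open>xpow\<close> is injective and matches \<le> with divisibility,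
    minimality among the monomials of \<open>M\<close> is minimality among nonfailure
    states.\<close>
  then have min: "xpow \<alpha> \<in> minimal_generators M \<longleftrightarrow> \<alpha> \<in> minimal_nonfailure F" for \<alpha>
    by (simp add: minimal_generators_def minimal_nonfailure_def xpow_dvd_iff
        inj_eq[OF inj_xpow] inj_image_mem_iff[OF inj_xpow])
  \<comment> \<open>\<open>min\<close> only speaks of elements of the form
    \<open>xpow \<alpha>\<close>; equality of the sets also needs that there are no others.\<close>
  have "minimal_generators M \<subseteq> range xpow"
    by (auto simp: minimal_generators_def)
  with min have "minimal_generators M = xpow ` minimal_nonfailure F"
    by blast
  moreover have "monomial_ideal M"
    using assms(2) by (auto simp: monomial_ideal_def)
  moreover have "\<alpha> \<in> F \<longleftrightarrow> xpow \<alpha> \<notin> M" for \<alpha>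
    by (simp add: mem nonfailure_def)
  ultimately show ?thesis
    using mem min by blast
qed

end
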